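(* Let $\mathcal Q$ be a $\sigma$-ring. Then $\mathcal M(\mathcal Q,\mathbb R)$ is a real subspace of $\mathcal M(\mathcal Q,\mathbb C)$. Every $\mu\in\mathcal M(\mathcal Q,\mathbb C)$ has a unique representation $\mu=\mu'+i\mu''$, where $\mu',\mu''\in\mathcal M(\mathcal Q,\mathbb R)$.
   Context: For a map $f$, $D_f$ denotes its domain. "Countable" includes finite and empty. A ring (of sets) is a nonempty set $\mathcal Q$ of sets such that $A\cup B\in\mathcal Q$ and $A\setminus B\in\mathcal Q$ for all $A,B\in\mathcal Q$. A $\delta$-ring is a ring closed under intersections of nonempty countable families; a $\sigma$-ring is a ring closed under countable unions. For a set of sets $\mathcal K$, $\sigma(\mathcal K)$ is the smallest $\sigma$-ring containing $\mathcal K$. A family $\mathbf A\colon I\to\mathcal Q$ is a partition of $A$ (into elements of $\mathcal Q$) if $\mathbf A(i)\cap\mathbf A(j)=\varnothing$ for $i\ne j$ and $\bigcup_{i\in I}\mathbf A(i)=A$ (members may be empty and $I$ may be empty); it is countable if $I$ is countable. Let $\mathfrak A$ be $\mathbb R$ or $\mathbb C$ with the usual topology. A family $f\colon I\to\mathfrak A$ is summable if the net $J\mapsto\sum_{i\in J}f(i)$ over the finite subsets $J\subset I$, directed by inclusion, converges in $\mathfrak A$; its limit is denoted $\sum f$. An $\mathfrak A$-valued premeasure is a map $\mu\colon D_\mu\to\mathfrak A$ whose domain $D_\mu$ is a $\delta$-ring and such that for every $A\in D_\mu$ and every countable partition $\mathbf A$ of $A$ into elements of $D_\mu$, the family $\mu\circ\mathbf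 A$ is summable and $\mu(A)=\sum\mu\circ\mathbf A$. The host $\sigma$-ring of a map $\mu$ is $\mathscr H[\mu]=\sigma(D_\mu)$. Maps $\mu,\nu$ are similar, $\mu\asymp\nu$, if $\mathscr H[\mu]=\mathscr H[\nu]$ and $\mu,\nu$ coincide on $D_\mu\cap D_\nu$. An $\mathfrak A$-valued measure is an $\mathfrak A$-valued premeasure $\mu$ which is an extension of every $\mathfrak A$-valued premeasure $\nu$ with $\nu\asymp\mu$. For every $\mathfrak A$-valued premeasure $\mu$ there is a unique $\mathfrak A$-valued measure similar to $\mu$; it is denoted $[\![\mu]\!]_{\mathfrak A}$. $\mathcal M(\mathcal Q,\mathfrak A)$ is the set of all $\mathfrak A$-valued measures $\mu$ with $\mathscr H[\mu]=\mathcal Q$; it is a vector space over $\mathfrak A$ with the operations $\mu+\nu=[\![\mu\dotplus\nu]\!]_{\mathfrak A}$, where $\mu\dotplus\nu$ is the pointwise sum defined on $D_\mu\cap D_\nu$, and $k\mu=[\![k\cdot\mu]\!]_{\mathfrak A}$, where $k\cdot\mu$ is the pointwise multiple $A\mapsto k\mu(A)$ on $D_\mu$. In the claim, $\mu'+i\mu''$ is computed in $\mathcal M(\mathcal Q,\mathbb C)$. *)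

theory Defs
  imports "HOL-Analysis.Analysis"
begin

text \<open>
  Sets are subsets of a type \<open>'a\<close>; a map \<open>\<mu>\<close> with domain \<open>D\<^sub>\<mu>\<close> is a partial function
  \<open>'a set \<rightharpoonup> 'k\<close>, with \<open>D\<^sub>\<mu> = dom \<mu>\<close>. Two such maps are equal iff they have the same domain and the
  same values on it, and ``\<open>\<mu>\<close> extends \<open>\<nu>\<close>'' is \<open>\<nu> \<subseteq>\<^sub>m \<mu>\<close>. The scalars \<open>'k\<close> are meant
  to be \<open>real\<close> or \<open>complex\<close>.
\<close>

text \<open>The space \<open>UNIV\<close> in \<open>ring_of_sets\<close> imposes no condition.\<close>

definition delta_ring_of_sets :: "'a set set \<Rightarrow> bool" where
  "delta_ring_of_sets Q \<longleftrightarrow> ring_of_sets UNIV Q \<and>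
     (\<forall>F. F \<subseteq> Q \<longrightarrow> F \<noteq> {} \<longrightarrow> countable F \<longrightarrow> \<Inter>F \<in> Q)"

definition sigma_ring_of_sets :: "'a set set \<Rightarrow> bool" where
  "sigma_ring_of_sets Q \<longleftrightarrow> ring_of_sets UNIV Q \<and>
     (\<forall>F. F \<subseteq> Q \<longrightarrow> countable F \<longrightarrow> \<Union>F \<in> Q)"

definition sigma_ring_generated :: "'a set set \<Rightarrow> 'a set set" where
  "sigma_ring_generated K = \<Inter>{S. sigma_ring_of_sets S \<and> K \<subseteq> S}"

text \<open>A countable index set is taken, without loss of generality, to be a set of natural numbers
  (finite, infinite or empty); members of the partition may be empty.\<close>

definition countable_partition_into ::
    "'a set set \<Rightarrow> nat set \<Rightarrow> (nat \<Rightarrow> 'a set) \<Rightarrow> 'a set \<Rightarrow> bool" where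
  "countable_partition_into Q I P A \<longleftrightarrow>
     P ` I \<subseteq> Q \<and> disjoint_family_on P I \<and> (\<Union>i\<in>I. P i) = A"

definition is_premeasure :: "('a set \<rightharpoonup> 'k::real_normed_field) \<Rightarrow> bool" where
  "is_premeasure \<mu> \<longleftrightarrow> delta_ring_of_sets (dom \<mu>) \<and>
     (\<forall>A\<in>dom \<mu>. \<forall>I P. countable_partition_into (dom \<mu>) I P A \<longrightarrow>
        ((\<lambda>i. the (\<mu> (P i))) has_sum the (\<mu> A)) I)"

definition host :: "('a set \<rightharpoonup> 'k) \<Rightarrow> 'a set set" where
  "host \<mu> = sigma_ring_generated (dom \<mu>)"

definition similar :: "('a set \<rightharpoonup> 'k) \<Rightarrow> ('a set \<rightharpoonup> 'k) \<Rightarrow> bool"  (infix "\<asymp>" 50) where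
  "\<mu> \<asymp> \<nu> \<longleftrightarrow> host \<mu> = host \<nu> \<and> (\<forall>A\<in>dom \<mu> \<inter> dom \<nu>. \<mu> A = \<nu> A)"

definition is_measure :: "('a set \<rightharpoonup> 'k::real_normed_field) \<Rightarrow> bool" where
  "is_measure \<mu> \<longleftrightarrow> is_premeasure \<mu> \<and> (\<forall>\<nu>. is_premeasure \<nu> \<longrightarrow> \<nu> \<asymp> \<mu> \<longrightarrow> \<nu> \<subseteq>\<^sub>m \<mu>)"

text \<open>Meaningful for premeasures \<open>\<mu>\<close>, for which the measure similar to \<open>\<mu>\<close> exists and is unique.\<close>

definition measure_similar_to :: "('a set \<rightharpoonup> 'k::real_normed_field) \<Rightarrow> ('a set \<rightharpoonup> 'k)" where
  "measure_similar_to \<mu> = (THE \<nu>. is_measure \<nu> \<and> \<nu> \<asymp> \<mu>)"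

definition measures_on :: "'a set set \<Rightarrow> ('a set \<rightharpoonup> 'k::real_normed_field) set" where
  "measures_on Q = {\<mu>. is_measure \<mu> \<and> host \<mu> = Q}"

definition pointwise_add ::
    "('a set \<rightharpoonup> 'k::real_normed_field) \<Rightarrow> ('a set \<rightharpoonup> 'k) \<Rightarrow> ('a set \<rightharpoonup> 'k)" where
  "pointwise_add \<mu> \<nu> =
     (\<lambda>A. if A \<in> dom \<mu> \<inter> dom \<nu> then Some (the (\<mu> A) + the (\<nu> A)) else None)"

definition pointwise_scale :: "'k::real_normed_field \<Rightarrow> ('a set \<rightharpoonup> 'k) \<Rightarrow> ('a set \<rightharpoonup> 'k)" where
  "pointwise_scale k \<mu> = (\<lambda>A. map_option (\<lambda>x. k * x) (\<mu> A))"

definition measure_add ::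
    "('a set \<rightharpoonup> 'k::real_normed_field) \<Rightarrow> ('a set \<rightharpoonup> 'k) \<Rightarrow> ('a set \<rightharpoonup> 'k)"  (infixl "\<oplus>\<^sub>m" 65) where
  "\<mu> \<oplus>\<^sub>m \<nu> = measure_similar_to (pointwise_add \<mu> \<nu>)"

definition measure_scale ::
    "'k::real_normed_field \<Rightarrow> ('a set \<rightharpoonup> 'k) \<Rightarrow> ('a set \<rightharpoonup> 'k)"  (infixr "\<odot>\<^sub>m" 75) where
  "k \<odot>\<^sub>m \<mu> = measure_similar_to (pointwise_scale k \<mu>)"

text \<open>The zero vector of \<open>measures_on Q\<close>, for a \<open>\<sigma>\<close>-ring \<open>Q\<close>: the zero map is a premeasure
  on \<open>Q\<close>, and it is maximal because its domain is the whole host \<open>\<sigma>\<close>-ring.\<close>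

definition measure_zero :: "'a set set \<Rightarrow> ('a set \<rightharpoonup> 'k::real_normed_field)" where
  "measure_zero Q = (\<lambda>A. if A \<in> Q then Some 0 else None)"

text \<open>A real-valued map regarded as a complex-valued one.\<close>

definition complexify :: "('a set \<rightharpoonup> real) \<Rightarrow> ('a set \<rightharpoonup> complex)" where
  "complexify \<mu> = (\<lambda>A. map_option complex_of_real (\<mu> A))"

text \<open>Real linear subspaces of the complex vector space \<open>measures_on Q\<close>. This is \<open>subspace\<close> of
  the theory \<open>HOL.Modules\<close> written out for this space, which is not a whole type.\<close>

definition real_subspace_of_measures :: "'a set set \<Rightarrow> ('a set \<rightharpoonup> complex) set \<Rightarrow> bool" where
  "real_subspace_of_measures Q S \<longleftrightarrow>
     S \<subseteq> measures_on Q \<and>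
     measure_zero Q \<in> S \<and>
     (\<forall>\<mu>\<in>S. \<forall>\<nu>\<in>S. \<mu> \<oplus>\<^sub>m \<nu> \<in> S) \<and>
     (\<forall>c::real. \<forall>\<mu>\<in>S. complex_of_real c \<odot>\<^sub>m \<mu> \<in> S)"

end

theory Submission
  imports Defs
begin

text \<open>
  A \<open>\<delta>\<close>-ring \<open>D\<close> is an ideal of \<open>\<sigma>(D)\<close>, and every element of \<open>\<sigma>(D)\<close> has a countable partition into
  elements of \<open>D\<close>. Hence premeasures with host \<open>Q\<close> are similar as soon as they agree on a
  \<open>\<delta>\<close>-ring generating \<open>Q\<close>. The measure similar to a premeasure \<open>\<mu>\<close> is defined on those \<open>A\<close> in
  the host for which \<open>\<mu>\<close> is summable along every countable partition of \<open>A\<close> into elements of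
  \<open>D\<^sub>\<mu>\<close>; its value is the common sum. The real and imaginary parts of a complex
  measure are the measures similar to \<open>Re \<circ> \<mu>\<close> and \<open>Im \<circ> \<mu>\<close>; for uniqueness, a real
  measure \<open>p\<close> with \<open>\<mu> = p + iq\<close> is compared with \<open>Re \<circ> \<mu>\<close> on the \<open>\<delta>\<close>-ring \<open>D\<^sub>q\<close>.
\<close>

section \<open>Generated \<sigma>-rings and \<delta>-rings\<close>

lemma sigma_ring_generated_superset: "K \<subseteq> sigma_ring_generated K"
  by (auto simp: sigma_ring_generated_def)

lemma sigma_ring_generated_minimal:
  assumes "sigma_ring_of_sets S" "K \<subseteq> S"
  shows "sigma_ring_generated K \<subseteq> S"
  using assms by (auto simp: sigma_ring_generated_def)

lemma sigma_ring_sigma_ring_generated: "sigma_ring_of_sets (sigma_ring_generated K)"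
proof -
  have "\<Union>F \<in> S"
    if "F \<subseteq> sigma_ring_generated K" "countable F" "sigma_ring_of_sets S" "K \<subseteq> S" for F S
    using that sigma_ring_generated_minimal[OF that(3,4)] unfolding sigma_ring_of_sets_def
    by (metis subset_trans)
  then show ?thesis
    unfolding sigma_ring_of_sets_def[of "sigma_ring_generated K"] ring_of_sets_iff
    by (auto simp: sigma_ring_generated_def)
      (auto simp: sigma_ring_of_sets_def ring_of_sets_iff)
qed

lemma sigma_ring_generated_eqI:
  assumes "K \<subseteq> sigma_ring_generated L" "L \<subseteq> sigma_ring_generated K"
  shows "sigma_ring_generated K = sigma_ring_generated L"
  by (intro equalityI sigma_ring_generated_minimal sigma_ring_sigma_ring_generated assms)

lemma sigma_ring_Diff:
  "sigma_ring_of_sets S \<Longrightarrow> A \<in> S \<Longrightarrow> B \<in> S \<Longrightarrow> A - B \<in> S"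
  by (simp add: sigma_ring_of_sets_def ring_of_sets_iff)

text \<open>Complements relative to one fixed member of \<open>F\<close> turn the intersection into
  a countable union; nonemptiness of \<open>F\<close> supplies that member.\<close>

lemma sigma_ring_Inter:
  assumes "sigma_ring_of_sets S" "F \<subseteq> S" "F \<noteq> {}" "countable F"
  shows "\<Inter>F \<in> S"
proof -
  obtain A where A: "A \<in> F" using assms(3) by blast
  have "(\<lambda>B. A - B) ` F \<subseteq> S"
    using assms(1,2) A by (auto intro: sigma_ring_Diff)
  then have "\<Union>((\<lambda>B. A - B) ` F) \<in> S"
    using assms(1,4) unfolding sigma_ring_of_sets_def by blast
  then have "A - \<Union>((\<lambda>B. A - B) ` F) \<in> S"
    using assms(1,2) A sigma_ring_Diff[OF assms(1)] by blast
  moreover have "A - \<Union>((\<lambda>B. A - B) ` F) = \<Inter>F" using A by blast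
  ultimately show ?thesis by simp
qed

lemma delta_ring_Int:
  assumes "delta_ring_of_sets D" "A \<in> D" "B \<in> D"
  shows "A \<inter> B \<in> D"
proof -
  have "A \<inter> B = A - (A - B)" by blast
  then show ?thesis
    using assms by (simp add: delta_ring_of_sets_def ring_of_sets_iff)
qed

lemma sigma_ring_imp_delta_ring:
  "sigma_ring_of_sets S \<Longrightarrow> delta_ring_of_sets S"
  using sigma_ring_Inter unfolding delta_ring_of_sets_def
  by (auto simp: sigma_ring_of_sets_def)

text \<open>This is the ideal property. The sets whose intersection with every element of
  \<open>D\<close> stays in \<open>D\<close> form a \<sigma>-ring, and it contains \<open>D\<close>,
  so it contains everything generated by \<open>D\<close>.\<close>

lemma sigma_ring_generated_Int_mem:
  assumes D: "delta_ring_of_sets D" and A: "A \<in> D" and B: "B \<in> sigma_ring_generated D"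
  shows "A \<inter> B \<in> D"
proof -
  let ?S = "{B. \<forall>A\<in>D. A \<inter> B \<in> D}"
  have diff: "X - Y \<in> D" and un: "X \<union> Y \<in> D" and em: "{} \<in> D" if "X \<in> D" "Y \<in> D" for X Y
    using D that by (auto simp: delta_ring_of_sets_def ring_of_sets_iff)
  have "sigma_ring_of_sets ?S"
    unfolding sigma_ring_of_sets_def ring_of_sets_iff
  proof (intro conjI ballI allI impI)
    show "{} \<in> ?S" using A em by auto
    fix X Y assume X: "X \<in> ?S" and Y: "Y \<in> ?S"
    have "C \<inter> (X \<union> Y) = (C \<inter> X) \<union> (C \<inter> Y)" "C \<inter> (X - Y) = (C \<inter> X) - (C \<inter> Y)" for C
      by blast+
    then show "X \<union> Y \<in> ?S" "X - Y \<in> ?S" using X Y by (auto intro: un diff)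
  next
    fix F assume F: "F \<subseteq> ?S" "countable F"
    have "C \<inter> \<Union>F \<in> D" if C: "C \<in> D" for C
    proof -
      \<comment> \<open>A \<delta>-ring is only closed under countable intersections, so the union
        is taken inside \<open>C\<close> by complementation. Inserting \<open>C\<close> changes
        nothing in the intersection but keeps the family nonempty when \<open>F\<close> is
        empty.\<close>
      let ?G = "insert C ((\<lambda>X. C - (C \<inter> X)) ` F)"
      have "?G \<subseteq> D" using F C by (auto intro!: diff)
      then have "\<Inter>?G \<in> D"
        using D F(2) unfolding delta_ring_of_sets_def
        by (metis countable_image countable_insert insert_not_empty)
      then have "C - \<Inter>?G \<in> D" using C by (rule diff[rotated])
      moreover have "C - \<Inter>?G = C \<inter> \<Union>F" by blast
      ultimately show ?thesis by simp
    qed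
    then show "\<Union>F \<in> ?S" by blast
  qed auto
  then have "sigma_ring_generated D \<subseteq> ?S"
    by (rule sigma_ring_generated_minimal) (use D delta_ring_Int in auto)
  then show ?thesis using A B by blast
qed

lemma sigma_ring_generated_subset_mem:
  assumes "delta_ring_of_sets D" "A \<in> D" "B \<in> sigma_ring_generated D" "B \<subseteq> A"
  shows "B \<in> D"
  using sigma_ring_generated_Int_mem[OF assms(1-3)] assms(4) by (simp add: Int_absorb1)

text \<open>The sets that can be covered by countably many elements of \<open>D\<close> form a
  \<sigma>-ring: differences only shrink a set, and a countable union of countable covers is a
  countable cover.\<close>

lemma sigma_ring_generated_cover:
  assumes "A \<in> sigma_ring_generated D"
  obtains F where "countable F" "F \<subseteq> D" "A \<subseteq> \<Union>F"
proof -
  let ?S = "{A. \<exists>F. countable F \<and> F \<subseteq> D \<and> A \<subseteq> \<Union>F}"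
  have "sigma_ring_of_sets ?S"
    unfolding sigma_ring_of_sets_def ring_of_sets_iff
  proof (intro conjI ballI allI impI)
    show "{} \<in> ?S" by auto
    fix X Y assume "X \<in> ?S" "Y \<in> ?S"
    then obtain F G where "countable F" "F \<subseteq> D" "X \<subseteq> \<Union>F" "countable G" "G \<subseteq> D" "Y \<subseteq> \<Union>G"
      by blast
    then have "countable (F \<union> G) \<and> F \<union> G \<subseteq> D \<and> X \<union> Y \<subseteq> \<Union>(F \<union> G)" by auto
    then show "X \<union> Y \<in> ?S" by blast
    have "X - Y \<subseteq> \<Union>F" using \<open>X \<subseteq> \<Union>F\<close> by blast
    then show "X - Y \<in> ?S" using \<open>countable F\<close> \<open>F \<subseteq> D\<close> by auto
  next
    fix \<F> assume \<F>: "\<F> \<subseteq> ?S" "countable \<F>"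
    then have "\<forall>X\<in>\<F>. \<exists>F. countable F \<and> F \<subseteq> D \<and> X \<subseteq> \<Union>F" by blast
    then obtain G where G: "\<forall>X\<in>\<F>. countable (G X) \<and> G X \<subseteq> D \<and> X \<subseteq> \<Union>(G X)"
      using bchoice[of \<F> "\<lambda>X F. countable F \<and> F \<subseteq> D \<and> X \<subseteq> \<Union>F"] by blast
    then have "countable (\<Union>(G ` \<F>))" using \<F>(2) by simp
    moreover have "\<Union>(G ` \<F>) \<subseteq> D" using G by blast
    moreover have "\<Union>\<F> \<subseteq> \<Union>(\<Union>(G ` \<F>))"
    proof
      fix x assume "x \<in> \<Union>\<F>"
      then obtain X where "X \<in> \<F>" "x \<in> X" by blast
      moreover from this obtain Y where "Y \<in> G X" "x \<in> Y"
        using G[rule_format, of X] by auto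
      ultimately show "x \<in> \<Union>(\<Union>(G ` \<F>))" by auto
    qed
    ultimately show "\<Union>\<F> \<in> ?S" by blast
  qed auto
  moreover have "D \<subseteq> ?S"
  proof
    fix X assume "X \<in> D"
    then have "countable {X} \<and> {X} \<subseteq> D \<and> X \<subseteq> \<Union>{X}" by auto
    then show "X \<in> ?S" by blast
  qed
  ultimately have "sigma_ring_generated D \<subseteq> ?S" by (rule sigma_ring_generated_minimal)
  then show ?thesis using assms that by blast
qed

text \<open>Cut a countable cover down to \<open>A\<close>, which stays in \<open>D\<close> by the
  ideal property, and make the resulting sequence disjoint, which uses only the ring operations of
  \<open>D\<close>.\<close>

lemma sigma_ring_generated_partition:
  assumes D: "delta_ring_of_sets D" and A: "A \<in> sigma_ring_generated D"
  obtains P where "countable_partition_into D UNIV P A"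
proof -
  obtain F where F: "countable F" "F \<subseteq> D" "A \<subseteq> \<Union>F"
    using A by (rule sigma_ring_generated_cover)
  interpret ring_of_sets UNIV D using D by (simp add: delta_ring_of_sets_def)
  \<comment> \<open>The enumeration of a countable set as a sequence needs a nonempty set. Adding
    \<open>{}\<close> secures this even for an empty cover and does not change the union.\<close>
  let ?B = "\<lambda>n. from_nat_into (insert {} F) n \<inter> A"
  have rng: "range (from_nat_into (insert {} F)) = insert {} F"
    using F(1) by (intro range_from_nat_into) auto
  have "range ?B \<subseteq> D"
    using F(2) rng by (auto intro!: sigma_ring_generated_Int_mem[OF D _ A])
      (metis empty_sets insertE rangeI subsetD)
  then have "range (disjointed ?B) \<subseteq> D" by (rule range_disjointed_sets)
  moreover have "(\<Union>n. disjointed ?B n) = A"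
  proof -
    have "(\<Union>n. ?B n) = \<Union>(range (from_nat_into (insert {} F))) \<inter> A" by blast
    also have "\<dots> = A" using F(3) unfolding rng by auto
    finally show ?thesis by (simp add: UN_disjointed_eq)
  qed
  ultimately have "countable_partition_into D UNIV (disjointed ?B) A"
    by (simp add: countable_partition_into_def disjoint_family_disjointed)
  then show ?thesis by (rule that)
qed

text \<open>An element \<open>A\<close> of \<open>D\<close> has a countable partition into elements
  of \<open>E\<close>. Its members are subsets of \<open>A\<close> in the common \<sigma>-ring,
  hence also in \<open>D\<close> by the ideal property. So \<open>A\<close> is a countable union of
  elements of \<open>D \<inter> E\<close>.\<close>

lemma delta_ring_Int_same_sigma_ring:
  assumes D: "delta_ring_of_sets D" and E: "delta_ring_of_sets E"
    and eq: "sigma_ring_generated D = sigma_ring_generated E"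
  shows "delta_ring_of_sets (D \<inter> E)"
    and "sigma_ring_generated (D \<inter> E) = sigma_ring_generated D"
proof -
  show "delta_ring_of_sets (D \<inter> E)"
    using D E unfolding delta_ring_of_sets_def ring_of_sets_iff by auto
  have S: "sigma_ring_of_sets (sigma_ring_generated (D \<inter> E))"
    by (rule sigma_ring_sigma_ring_generated)
  have "A \<in> sigma_ring_generated (D \<inter> E)" if A: "A \<in> D" for A
  proof -
    have "A \<in> sigma_ring_generated E" using A sigma_ring_generated_superset eq by blast
    then obtain P where P: "countable_partition_into E UNIV P A"
      by (rule sigma_ring_generated_partition[OF E])
    then have PE: "range P \<subseteq> E" and UN: "\<Union>(range P) = A"
      by (auto simp: countable_partition_into_def)
    have "P n \<in> D" for n
    proof (rule sigma_ring_generated_subset_mem[OF D A])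
      show "P n \<in> sigma_ring_generated D"
        using PE sigma_ring_generated_superset[of E] unfolding eq by blast
      show "P n \<subseteq> A" using UN by blast
    qed
    then have "range P \<subseteq> sigma_ring_generated (D \<inter> E)"
      using PE sigma_ring_generated_superset[of "D \<inter> E"] by blast
    then have "\<Union>(range P) \<in> sigma_ring_generated (D \<inter> E)"
      using S by (simp add: sigma_ring_of_sets_def)
    then show ?thesis unfolding UN .
  qed
  moreover have "D \<inter> E \<subseteq> sigma_ring_generated D"
    using sigma_ring_generated_superset[of D] by blast
  ultimately show "sigma_ring_generated (D \<inter> E) = sigma_ring_generated D"
    by (intro sigma_ring_generated_eqI) auto
qed

section \<open>Premeasures and reindexing of countable partitions\<close>

lemma is_premeasure_dom: "is_premeasure \<mu> \<Longrightarrow> delta_ring_of_sets (dom \<mu>)"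
  by (simp add: is_premeasure_def)

lemma is_premeasure_has_sum:
  assumes "is_premeasure \<mu>" "A \<in> dom \<mu>" "countable_partition_into (dom \<mu>) I P A"
  shows "((\<lambda>i. the (\<mu> (P i))) has_sum the (\<mu> A)) I"
  using assms by (simp add: is_premeasure_def)

lemma dom_subset_host: "dom \<mu> \<subseteq> host \<mu>"
  by (simp add: host_def sigma_ring_generated_superset)

lemma sigma_ring_host: "sigma_ring_of_sets (host \<mu>)"
  by (simp add: host_def sigma_ring_sigma_ring_generated)

lemma premeasure_subset_mem:
  assumes "is_premeasure \<mu>" "A \<in> dom \<mu>" "B \<in> host \<mu>" "B \<subseteq> A"
  shows "B \<in> dom \<mu>"
  using sigma_ring_generated_subset_mem[OF is_premeasure_dom[OF assms(1)]] assms(2-)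
  by (auto simp: host_def)

text \<open>Partitions are indexed by sets of naturals by definition, while common refinements and
  glued partitions are naturally indexed by products and disjoint sums. This lemma and the next
  carry such families over.\<close>

lemma countable_partition_reindex:
  fixes P :: "'i \<Rightarrow> 'a set"
  assumes I: "countable I" and P: "P ` I \<subseteq> D" "disjoint_family_on P I" "(\<Union>i\<in>I. P i) = A"
  shows "countable_partition_into D (to_nat_on I ` I) (P \<circ> from_nat_into I) A"
  unfolding countable_partition_into_def
proof (intro conjI)
  show "(P \<circ> from_nat_into I) ` to_nat_on I ` I \<subseteq> D"
    using I P(1) by (auto simp: image_image)
  show "disjoint_family_on (P \<circ> from_nat_into I) (to_nat_on I ` I)"
    using I P(2) by (auto simp: disjoint_family_on_def)
  show "(\<Union>i\<in>to_nat_on I ` I. (P \<circ> from_nat_into I) i) = A"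
    using I P(3) by auto
qed

lemma has_sum_countable_partition_reindex:
  assumes "countable I"
  shows "((\<lambda>n. f ((P \<circ> from_nat_into I) n)) has_sum x) (to_nat_on I ` I)
    \<longleftrightarrow> ((\<lambda>i. f (P i)) has_sum x) I"
proof -
  have "((\<lambda>n. f ((P \<circ> from_nat_into I) n)) has_sum x) (to_nat_on I ` I)
    \<longleftrightarrow> (((\<lambda>n. f ((P \<circ> from_nat_into I) n)) \<circ> to_nat_on I) has_sum x) I"
    by (rule has_sum_reindex) (use assms inj_on_to_nat_on in blast)
  also have "\<dots> \<longleftrightarrow> ((\<lambda>i. f (P i)) has_sum x) I"
    by (rule has_sum_cong) (use assms in auto)
  finally show ?thesis .
qed

section \<open>Sets along whose partitions a premeasure is summable\<close>

text \<open>This condition cuts out the largest possible domain: countable additivity of a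
  premeasure similar to \<open>\<mu>\<close> forces it on every set of that premeasure's
  domain.\<close>

definition summable_partitions :: "('a set \<rightharpoonup> 'k::real_normed_field) \<Rightarrow> 'a set \<Rightarrow> bool" where
  "summable_partitions \<mu> A \<longleftrightarrow> A \<in> host \<mu> \<and>
     (\<forall>I P. countable_partition_into (dom \<mu>) I P A \<longrightarrow> (\<lambda>i. the (\<mu> (P i))) summable_on I)"

lemma summable_partitions_countable:
  assumes "summable_partitions \<mu> A" "countable I"
    and "P ` I \<subseteq> dom \<mu>" "disjoint_family_on P I" "(\<Union>i\<in>I. P i) = A"
  shows "(\<lambda>i. the (\<mu> (P i))) summable_on I"
  using assms(1) countable_partition_reindex[OF assms(2-5)]
    has_sum_countable_partition_reindex[OF assms(2), of "\<lambda>A. the (\<mu> A)" P]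
  unfolding summable_partitions_def summable_on_def by metis

lemma countable_partition_restrict:
  assumes "countable_partition_into E I P A" "B \<subseteq> A" "\<And>i. i \<in> I \<Longrightarrow> B \<inter> P i \<in> D"
  shows "countable_partition_into D I (\<lambda>i. B \<inter> P i) B"
proof -
  have "disjoint_family_on (\<lambda>i. B \<inter> P i) I"
    by (rule disjoint_family_on_bisimulation[of P])
      (use assms(1) in \<open>auto simp: countable_partition_into_def\<close>)
  then show ?thesis using assms by (auto simp: countable_partition_into_def)
qed

text \<open>Both sums are compared with the sum over the common refinement \<open>P i \<inter> Q j\<close>.\<close>

lemma summable_partitions_has_sum_eq:
  fixes \<mu> :: "'a set \<rightharpoonup> 'k::{real_normed_field,banach}"
  assumes \<mu>: "is_premeasure \<mu>" and A: "summable_partitions \<mu> A"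
    and P: "countable_partition_into (dom \<mu>) I P A"
    and Q: "countable_partition_into (dom \<mu>) J Q A"
    and x: "((\<lambda>j. the (\<mu> (Q j))) has_sum x) J"
  shows "((\<lambda>i. the (\<mu> (P i))) has_sum x) I"
proof -
  have Pm: "P i \<in> dom \<mu>" "P i \<subseteq> A" if "i \<in> I" for i
    using P that by (auto simp: countable_partition_into_def)
  have Qm: "Q j \<in> dom \<mu>" "Q j \<subseteq> A" if "j \<in> J" for j
    using Q that by (auto simp: countable_partition_into_def)
  have D: "P i \<inter> Q j \<in> dom \<mu>" if "i \<in> I" "j \<in> J" for i j
    using that by (intro delta_ring_Int is_premeasure_dom[OF \<mu>] Pm Qm)
  have Pi: "((\<lambda>j. the (\<mu> (P i \<inter> Q j))) has_sum the (\<mu> (P i))) J" if i: "i \<in> I" for i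
    using i by (intro is_premeasure_has_sum[OF \<mu>] countable_partition_restrict[OF Q] Pm D)
  have Qj: "((\<lambda>i. the (\<mu> (P i \<inter> Q j))) has_sum the (\<mu> (Q j))) I" if j: "j \<in> J" for j
    using is_premeasure_has_sum[OF \<mu> Qm(1)[OF j] countable_partition_restrict[OF P Qm(2)[OF j]]]
    by (simp add: Int_commute D j)
  \<comment> \<open>The row and column sums alone would not give summability on the product. It
    comes from the hypothesis on \<open>A\<close>, because the refinement is again a countable
    partition of \<open>A\<close> into elements of \<open>dom \<mu>\<close>.\<close>
  have "(\<lambda>ij. the (\<mu> (case ij of (i, j) \<Rightarrow> P i \<inter> Q j))) summable_on I \<times> J"
  proof (rule summable_partitions_countable[OF A])
    show "disjoint_family_on (\<lambda>(i, j). P i \<inter> Q j) (I \<times> J)"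
      using P Q unfolding countable_partition_into_def disjoint_family_on_def by blast
    have "(\<Union>ij\<in>I \<times> J. case ij of (i, j) \<Rightarrow> P i \<inter> Q j) = (\<Union>i\<in>I. P i) \<inter> (\<Union>j\<in>J. Q j)"
      by blast
    then show "(\<Union>ij\<in>I \<times> J. case ij of (i, j) \<Rightarrow> P i \<inter> Q j) = A"
      using P Q by (simp add: countable_partition_into_def)
  qed (use D in auto)
  then obtain y where y: "((\<lambda>(i, j). the (\<mu> (P i \<inter> Q j))) has_sum y) (I \<times> J)"
    by (auto simp: summable_on_def case_prod_unfold)
  then have y': "((\<lambda>(j, i). the (\<mu> (P i \<inter> Q j))) has_sum y) (J \<times> I)"
    by (subst (asm) has_sum_swap) (simp add: case_prod_unfold)
  have "((\<lambda>i. the (\<mu> (P i))) has_sum y) I"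
    by (rule has_sum_SigmaD[OF y]) (simp add: Pi)
  moreover have "((\<lambda>j. the (\<mu> (Q j))) has_sum y) J"
    by (rule has_sum_SigmaD[OF y']) (simp add: Qj)
  ultimately show ?thesis using has_sum_unique[OF x] by simp
qed

lemma summable_partitions_dom:
  assumes "is_premeasure \<mu>" "A \<in> dom \<mu>"
  shows "summable_partitions \<mu> A"
  using assms dom_subset_host[of \<mu>] is_premeasure_has_sum[OF assms]
  unfolding summable_partitions_def summable_on_def by blast

lemma host_partition:
  assumes "is_premeasure \<mu>" "A \<in> host \<mu>"
  obtains P where "countable_partition_into (dom \<mu>) UNIV P A"
  using sigma_ring_generated_partition[OF is_premeasure_dom[OF assms(1)]] assms(2)
  by (auto simp: host_def)

lemma host_Diff: "A \<in> host \<mu> \<Longrightarrow> B \<in> host \<mu> \<Longrightarrow> A - B \<in> host \<mu>"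
  by (rule sigma_ring_Diff[OF sigma_ring_host])

text \<open>A partition of \<open>B\<close>, glued to one of \<open>A - B\<close>, is a partition of
  \<open>A\<close>; the disjoint sum of index sets keeps the two families apart.\<close>

lemma summable_partitions_subset:
  fixes \<mu> :: "'a set \<rightharpoonup> 'k::{real_normed_field,banach}"
  assumes \<mu>: "is_premeasure \<mu>" and A: "summable_partitions \<mu> A"
    and B: "B \<in> host \<mu>" "B \<subseteq> A"
  shows "summable_partitions \<mu> B"
  unfolding summable_partitions_def
proof (intro conjI allI impI B)
  fix I P assume P: "countable_partition_into (dom \<mu>) I P B"
  have "A - B \<in> host \<mu>" using A B(1) by (intro host_Diff) (auto simp: summable_partitions_def)
  then obtain R where R: "countable_partition_into (dom \<mu>) UNIV R (A - B)"
    by (rule host_partition[OF \<mu>])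
  have PR: "P m \<inter> R n = {}" "R n \<inter> P m = {}" if "m \<in> I" for m n
    using P R that unfolding countable_partition_into_def by blast+
  have PP: "P m \<inter> P n = {}" if "m \<in> I" "n \<in> I" "m \<noteq> n" for m n
    using P that by (simp add: countable_partition_into_def disjoint_family_on_def)
  have RR: "R m \<inter> R n = {}" if "m \<noteq> n" for m n
    using R that by (simp add: countable_partition_into_def disjoint_family_on_def)
  have "(\<lambda>k. the (\<mu> (case_sum P R k))) summable_on I <+> (UNIV :: nat set)"
  proof (rule summable_partitions_countable[OF A])
    show "disjoint_family_on (case_sum P R) (I <+> (UNIV :: nat set))"
    proof (unfold disjoint_family_on_def, intro ballI impI)
      fix k l assume "k \<in> I <+> (UNIV :: nat set)" "l \<in> I <+> (UNIV :: nat set)" "k \<noteq> l"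
      then show "case_sum P R k \<inter> case_sum P R l = {}"
        by (cases k; cases l) (simp_all add: PR PP RR Plus_def image_iff)
    qed
    show "(\<Union>k\<in>I <+> (UNIV :: nat set). case_sum P R k) = A"
      using P R B(2) by (auto simp: countable_partition_into_def Plus_def)
  qed (use P R in \<open>auto simp: countable_partition_into_def\<close>)
  \<comment> \<open>Completeness of the scalars enters here: a subfamily of a summable family is
    summable.\<close>
  then have "(\<lambda>k. the (\<mu> (case_sum P R k))) summable_on Inl ` I"
    by (rule summable_on_subset_banach) auto
  then show "(\<lambda>i. the (\<mu> (P i))) summable_on I"
    by (subst (asm) summable_on_reindex) (auto simp: o_def)
qed

lemma premeasure_Un_disjoint:
  assumes \<mu>: "is_premeasure \<mu>" and AB: "A \<in> dom \<mu>" "B \<in> dom \<mu>" "A \<inter> B = {}"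
  shows "the (\<mu> (A \<union> B)) = the (\<mu> A) + the (\<mu> B)"
proof -
  have "A \<union> B \<in> dom \<mu>"
    using is_premeasure_dom[OF \<mu>] AB unfolding delta_ring_of_sets_def ring_of_sets_iff by blast
  moreover have "countable_partition_into (dom \<mu>) {0, 1} (\<lambda>i. if i = 0 then A else B) (A \<union> B)"
    using AB by (auto simp: countable_partition_into_def disjoint_family_on_def)
  ultimately have "((\<lambda>i. the (\<mu> (if i = 0 then A else B))) has_sum the (\<mu> (A \<union> B))) {0, 1 :: nat}"
    by (rule is_premeasure_has_sum[OF \<mu>])
  from has_sum_unique[OF this has_sum_finite] show ?thesis by simp
qed

text \<open>Intersecting a partition of \<open>A \<union> B\<close> with \<open>A\<close> and with
  \<open>B\<close> gives partitions of both, with members in \<open>dom \<mu>\<close> by the ideal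
  property. By finite additivity the original family is the sum of the two summable
  families.\<close>

lemma summable_partitions_Un_disjoint:
  assumes \<mu>: "is_premeasure \<mu>" and A: "summable_partitions \<mu> A" and B: "summable_partitions \<mu> B"
    and disj: "A \<inter> B = {}"
  shows "summable_partitions \<mu> (A \<union> B)"
  unfolding summable_partitions_def
proof (intro conjI allI impI)
  have h: "A \<in> host \<mu>" "B \<in> host \<mu>" using A B by (auto simp: summable_partitions_def)
  then show "A \<union> B \<in> host \<mu>"
    using sigma_ring_host[of \<mu>] by (simp add: sigma_ring_of_sets_def ring_of_sets_iff)
  fix I P assume P: "countable_partition_into (dom \<mu>) I P (A \<union> B)"
  have Pm: "A \<inter> P i \<in> dom \<mu>" "B \<inter> P i \<in> dom \<mu>" if "i \<in> I" for i
    using P that h sigma_ring_generated_Int_mem[OF is_premeasure_dom[OF \<mu>], of "P i"]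
    unfolding countable_partition_into_def host_def Int_commute[of _ "P i"] by blast+
  have "(\<lambda>i. the (\<mu> (A \<inter> P i))) summable_on I"
    using A countable_partition_restrict[OF P, of A "dom \<mu>"] Pm
    by (auto simp: summable_partitions_def)
  moreover have "(\<lambda>i. the (\<mu> (B \<inter> P i))) summable_on I"
    using B countable_partition_restrict[OF P, of B "dom \<mu>"] Pm
    by (auto simp: summable_partitions_def)
  ultimately have "(\<lambda>i. the (\<mu> (A \<inter> P i)) + the (\<mu> (B \<inter> P i))) summable_on I"
    by (rule summable_on_add)
  moreover have "the (\<mu> (A \<inter> P i)) + the (\<mu> (B \<inter> P i)) = the (\<mu> (P i))" if i: "i \<in> I" for i
  proof -
    have "P i = (A \<inter> P i) \<union> (B \<inter> P i)" using P i by (auto simp: countable_partition_into_def)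
    then show ?thesis
      using premeasure_Un_disjoint[OF \<mu> Pm[OF i]] disj by (metis Int_empty_left inf_assoc inf_left_commute)
  qed
  ultimately show "(\<lambda>i. the (\<mu> (P i))) summable_on I" by (simp cong: summable_on_cong)
qed

section \<open>The maximal extension of a premeasure\<close>

text \<open>The choice operator picks the sum along some partition. For a premeasure with complete
  scalars the result does not depend on the partition, by
  \<open>summable_partitions_has_sum_eq\<close>.\<close>

definition maximal_extension :: "('a set \<rightharpoonup> 'k::real_normed_field) \<Rightarrow> ('a set \<rightharpoonup> 'k)" where
  "maximal_extension \<mu> = (\<lambda>A. if summable_partitions \<mu> A
     then Some (SOME x. \<exists>I P. countable_partition_into (dom \<mu>) I P A \<and>
       ((\<lambda>i. the (\<mu> (P i))) has_sum x) I) else None)"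

lemma dom_maximal_extension: "dom (maximal_extension \<mu>) = {A. summable_partitions \<mu> A}"
  by (auto simp: maximal_extension_def split: if_splits)

lemma maximal_extension_has_sum:
  fixes \<mu> :: "'a set \<rightharpoonup> 'k::{real_normed_field,banach}"
  assumes \<mu>: "is_premeasure \<mu>" and A: "summable_partitions \<mu> A"
    and P: "countable_partition_into (dom \<mu>) I P A"
  shows "((\<lambda>i. the (\<mu> (P i))) has_sum the (maximal_extension \<mu> A)) I"
proof -
  have "\<exists>x. ((\<lambda>i. the (\<mu> (P i))) has_sum x) I"
    using A P by (auto simp: summable_partitions_def summable_on_def)
  then have "\<exists>x I P. countable_partition_into (dom \<mu>) I P A \<and> ((\<lambda>i. the (\<mu> (P i))) has_sum x) I"
    using P by blast
  from someI_ex[OF this] A obtain J Q where "countable_partition_into (dom \<mu>) J Q A"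
    "((\<lambda>j. the (\<mu> (Q j))) has_sum the (maximal_extension \<mu> A)) J"
    by (auto simp: maximal_extension_def)
  then show ?thesis by (rule summable_partitions_has_sum_eq[OF \<mu> A P])
qed

lemma maximal_extension_has_sum_countable:
  fixes \<mu> :: "'a set \<rightharpoonup> 'k::{real_normed_field,banach}"
  assumes "is_premeasure \<mu>" "summable_partitions \<mu> A" "countable I"
    and "P ` I \<subseteq> dom \<mu>" "disjoint_family_on P I" "(\<Union>i\<in>I. P i) = A"
  shows "((\<lambda>i. the (\<mu> (P i))) has_sum the (maximal_extension \<mu> A)) I"
  using maximal_extension_has_sum[OF assms(1,2) countable_partition_reindex[OF assms(3-6)]]
    has_sum_countable_partition_reindex[OF assms(3), of "\<lambda>A. the (\<mu> A)" P]
  by simp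

lemma delta_ring_summable_partitions:
  fixes \<mu> :: "'a set \<rightharpoonup> 'k::{real_normed_field,banach}"
  assumes \<mu>: "is_premeasure \<mu>"
  shows "delta_ring_of_sets {A. summable_partitions \<mu> A}"
  unfolding delta_ring_of_sets_def ring_of_sets_iff
proof (intro conjI ballI allI impI)
  have "{} \<in> dom \<mu>"
    using is_premeasure_dom[OF \<mu>] by (simp add: delta_ring_of_sets_def ring_of_sets_iff)
  then show "{} \<in> {A. summable_partitions \<mu> A}" using summable_partitions_dom[OF \<mu>] by simp
next
  fix A B assume A: "A \<in> {A. summable_partitions \<mu> A}" and B: "B \<in> {A. summable_partitions \<mu> A}"
  have diff: "summable_partitions \<mu> (X - Y)"
    if "summable_partitions \<mu> X" "summable_partitions \<mu> Y" for X Y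
    by (rule summable_partitions_subset[OF \<mu> that(1)])
      (use that in \<open>auto simp: summable_partitions_def intro: host_Diff\<close>)
  then show "A - B \<in> {A. summable_partitions \<mu> A}" using A B by simp
  have "summable_partitions \<mu> (A \<union> (B - A))"
    using A B diff by (intro summable_partitions_Un_disjoint[OF \<mu>]) auto
  then show "A \<union> B \<in> {A. summable_partitions \<mu> A}" by simp
next
  fix F assume F: "F \<subseteq> {A. summable_partitions \<mu> A}" "F \<noteq> {}" "countable F"
  then obtain A where A: "A \<in> F" "summable_partitions \<mu> A" by blast
  \<comment> \<open>Passing to subsets suffices here: the intersection lies in the host and below
    one member of \<open>F\<close>.\<close>
  have "F \<subseteq> host \<mu>" using F(1) by (auto simp: summable_partitions_def)
  then have "\<Inter>F \<in> host \<mu>" using F by (intro sigma_ring_Inter[OF sigma_ring_host])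
  then have "summable_partitions \<mu> (\<Inter>F)"
    using A by (intro summable_partitions_subset[OF \<mu> A(2)]) auto
  then show "\<Inter>F \<in> {A. summable_partitions \<mu> A}" by simp
qed auto

text \<open>Each \<open>P i\<close> is split further into elements of \<open>dom \<mu>\<close>. All
  these pieces together form a countable partition of \<open>A\<close>, so their double sum is the
  value at \<open>A\<close>; grouping it by \<open>i\<close> yields the values at the
  \<open>P i\<close>.\<close>

lemma is_premeasure_maximal_extension:
  fixes \<mu> :: "'a set \<rightharpoonup> 'k::{real_normed_field,banach}"
  assumes \<mu>: "is_premeasure \<mu>"
  shows "is_premeasure (maximal_extension \<mu>)"
  unfolding is_premeasure_def dom_maximal_extension
proof (intro conjI ballI allI impI delta_ring_summable_partitions[OF \<mu>])
  fix A I P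
  assume A: "A \<in> {A. summable_partitions \<mu> A}"
    and P: "countable_partition_into {A. summable_partitions \<mu> A} I P A"
  have Pi: "summable_partitions \<mu> (P i)" if "i \<in> I" for i
    using P that by (auto simp: countable_partition_into_def)
  have "\<exists>R. countable_partition_into (dom \<mu>) UNIV R (P i)" if "i \<in> I" for i
    using host_partition[OF \<mu>, of "P i"] Pi[OF that] unfolding summable_partitions_def by blast
  then obtain R where R: "\<And>i. i \<in> I \<Longrightarrow> countable_partition_into (dom \<mu>) UNIV (R i) (P i)"
    by metis
  have Rm: "R i n \<in> dom \<mu>" "R i n \<subseteq> P i" "\<Union>(range (R i)) = P i" "disjoint_family (R i)"
    if "i \<in> I" for i n
    using R[OF that] by (auto simp: countable_partition_into_def)
  have "((\<lambda>k. the (\<mu> (case_prod R k))) has_sum the (maximal_extension \<mu> A)) (I \<times> (UNIV :: nat set))"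
  proof (rule maximal_extension_has_sum_countable[OF \<mu>])
    show "disjoint_family_on (case_prod R) (I \<times> (UNIV :: nat set))"
    proof (unfold disjoint_family_on_def, intro ballI impI)
      fix k l assume kl: "k \<in> I \<times> (UNIV :: nat set)" "l \<in> I \<times> (UNIV :: nat set)" "k \<noteq> l"
      show "case_prod R k \<inter> case_prod R l = {}"
      proof (cases "fst k = fst l")
        case True
        then have "snd k \<noteq> snd l" using kl(3) by (simp add: prod_eq_iff)
        then have "R (fst k) (snd k) \<inter> R (fst k) (snd l) = {}"
          using kl(1) by (intro disjoint_family_onD[OF Rm(4)]) auto
        then show ?thesis using True by (simp add: case_prod_unfold)
      next
        case False
        then have "P (fst k) \<inter> P (fst l) = {}"
          using P kl(1,2) unfolding countable_partition_into_def
          by (intro disjoint_family_onD[of P I]) auto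
        then show ?thesis using kl(1,2) Rm(2)[of "fst k" "snd k"] Rm(2)[of "fst l" "snd l"]
          by (simp add: case_prod_unfold mem_Times_iff) blast
      qed
    qed
    have "(\<Union>k\<in>I \<times> (UNIV :: nat set). case_prod R k) = (\<Union>i\<in>I. \<Union>(range (R i)))" by auto
    also have "\<dots> = A" using P Rm(3) by (simp add: countable_partition_into_def)
    finally show "(\<Union>k\<in>I \<times> (UNIV :: nat set). case_prod R k) = A" .
  qed (use A Rm in auto)
  moreover have "((\<lambda>n. the (\<mu> (case_prod R (i, n)))) has_sum the (maximal_extension \<mu> (P i))) UNIV"
    if "i \<in> I" for i
    using maximal_extension_has_sum[OF \<mu> Pi R] that by simp
  ultimately show "((\<lambda>i. the (maximal_extension \<mu> (P i))) has_sum the (maximal_extension \<mu> A)) I"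
    by (rule has_sum_SigmaD)
qed

section \<open>Similarity of premeasures and maximality of the extension\<close>

lemma similar_sym: "\<mu> \<asymp> \<nu> \<Longrightarrow> \<nu> \<asymp> \<mu>"
  by (auto simp: similar_def)

text \<open>\<open>E\<close> need not lie inside either domain. A set \<open>A\<close> in both
  domains is partitioned into elements of \<open>E\<close>; these are subsets of \<open>A\<close> in
  the common host, hence lie in both domains, and the two values at \<open>A\<close> are sums of the
  same terms.\<close>

lemma similarI_on_delta_ring:
  assumes \<mu>: "is_premeasure \<mu>" and \<nu>: "is_premeasure \<nu>" and E: "delta_ring_of_sets E"
    and host: "host \<mu> = sigma_ring_generated E" "host \<nu> = sigma_ring_generated E"
    and eq: "\<And>A. A \<in> E \<Longrightarrow> A \<in> dom \<mu> \<Longrightarrow> A \<in> dom \<nu> \<Longrightarrow> \<mu> A = \<nu> A"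
  shows "\<mu> \<asymp> \<nu>"
  unfolding similar_def
proof (intro conjI ballI)
  show "host \<mu> = host \<nu>" using host by simp
  fix A assume "A \<in> dom \<mu> \<inter> dom \<nu>"
  then have A: "A \<in> dom \<mu>" "A \<in> dom \<nu>" by auto
  then obtain P where P: "countable_partition_into E UNIV P A"
    using sigma_ring_generated_partition[OF E] dom_subset_host[of \<mu>] host by blast
  have PE: "P n \<in> E" "P n \<subseteq> A" for n using P by (auto simp: countable_partition_into_def)
  then have "P n \<in> sigma_ring_generated E" for n using sigma_ring_generated_superset by blast
  then have Pm: "P n \<in> dom \<mu>" "P n \<in> dom \<nu>" for n
    using premeasure_subset_mem[OF \<mu> A(1)] premeasure_subset_mem[OF \<nu> A(2)] PE host by simp_all
  have "((\<lambda>n. the (\<mu> (P n))) has_sum the (\<mu> A)) UNIV"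
    using P Pm by (intro is_premeasure_has_sum[OF \<mu> A(1)]) (auto simp: countable_partition_into_def)
  moreover have "((\<lambda>n. the (\<nu> (P n))) has_sum the (\<nu> A)) UNIV"
    using P Pm by (intro is_premeasure_has_sum[OF \<nu> A(2)]) (auto simp: countable_partition_into_def)
  ultimately have "the (\<mu> A) = the (\<nu> A)"
    using eq[OF PE(1) Pm] by (simp add: has_sum_unique)
  then show "\<mu> A = \<nu> A" using A by auto
qed

text \<open>A set in \<open>dom \<mu> \<inter> dom \<rho>\<close> may fail to lie in
  \<open>dom \<nu>\<close>, so the values cannot be compared directly. On the \<delta>-ring
  \<open>dom \<nu>\<close> they can, and that is enough.\<close>

lemma similar_trans:
  assumes "is_premeasure \<mu>" "is_premeasure \<nu>" "is_premeasure \<rho>" "\<mu> \<asymp> \<nu>" "\<nu> \<asymp> \<rho>"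
  shows "\<mu> \<asymp> \<rho>"
  by (rule similarI_on_delta_ring[OF assms(1,3) is_premeasure_dom[OF assms(2)]])
    (use assms(4,5) in \<open>auto simp: similar_def simp flip: host_def\<close>)

lemma maximal_extension_eq:
  fixes \<mu> :: "'a set \<rightharpoonup> 'k::{real_normed_field,banach}"
  assumes \<mu>: "is_premeasure \<mu>" and A: "A \<in> dom \<mu>"
  shows "maximal_extension \<mu> A = \<mu> A"
proof -
  have sA: "summable_partitions \<mu> A" by (rule summable_partitions_dom[OF \<mu> A])
  obtain P where P: "countable_partition_into (dom \<mu>) UNIV P A"
    by (rule host_partition[OF \<mu> subsetD[OF dom_subset_host A]])
  have "the (maximal_extension \<mu> A) = the (\<mu> A)"
    by (rule has_sum_unique[OF maximal_extension_has_sum[OF \<mu> sA P] is_premeasure_has_sum[OF \<mu> A P]])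
  moreover have "A \<in> dom (maximal_extension \<mu>)" using sA by (simp add: dom_maximal_extension)
  ultimately show ?thesis using A by auto
qed

lemma host_maximal_extension:
  fixes \<mu> :: "'a set \<rightharpoonup> 'k::{real_normed_field,banach}"
  assumes \<mu>: "is_premeasure \<mu>"
  shows "host (maximal_extension \<mu>) = host \<mu>"
proof -
  have "dom \<mu> \<subseteq> dom (maximal_extension \<mu>)"
    unfolding dom_maximal_extension using summable_partitions_dom[OF \<mu>] by auto
  moreover have "dom (maximal_extension \<mu>) \<subseteq> host \<mu>"
    by (auto simp: dom_maximal_extension summable_partitions_def)
  ultimately show ?thesis
    unfolding host_def
    by (intro sigma_ring_generated_eqI)
      (assumption, rule subset_trans[OF _ sigma_ring_generated_superset])
qed

lemma maximal_extension_similar: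
  fixes \<mu> :: "'a set \<rightharpoonup> 'k::{real_normed_field,banach}"
  assumes "is_premeasure \<mu>"
  shows "maximal_extension \<mu> \<asymp> \<mu>"
  using assms by (simp add: similar_def host_maximal_extension maximal_extension_eq)

text \<open>By transitivity a competitor \<open>\<rho>\<close> is similar to \<open>\<mu>\<close>.
  The members of a partition of \<open>A \<in> dom \<rho>\<close> into elements of
  \<open>dom \<mu>\<close> are subsets of \<open>A\<close>, so they lie in \<open>dom \<rho>\<close>
  too, and additivity of \<open>\<rho>\<close> gives the summability that puts \<open>A\<close> into
  the domain of the extension.\<close>

lemma is_measure_maximal_extension:
  fixes \<mu> :: "'a set \<rightharpoonup> 'k::{real_normed_field,banach}"
  assumes \<mu>: "is_premeasure \<mu>"
  shows "is_measure (maximal_extension \<mu>)"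
  unfolding is_measure_def
proof (intro conjI allI impI is_premeasure_maximal_extension[OF \<mu>])
  fix \<rho> :: "'a set \<rightharpoonup> 'k"
  assume \<rho>: "is_premeasure \<rho>" and sim: "\<rho> \<asymp> maximal_extension \<mu>"
  then have host: "host \<rho> = host \<mu>" by (simp add: similar_def host_maximal_extension[OF \<mu>])
  have "\<rho> \<asymp> \<mu>"
    by (rule similar_trans[OF \<rho> is_premeasure_maximal_extension[OF \<mu>] \<mu> sim
          maximal_extension_similar[OF \<mu>]])
  then have eq: "\<rho> B = \<mu> B" if "B \<in> dom \<rho>" "B \<in> dom \<mu>" for B
    using that by (simp add: similar_def)
  have "A \<in> dom (maximal_extension \<mu>)" if A: "A \<in> dom \<rho>" for A
  proof -
    have "(\<lambda>i. the (\<mu> (P i))) summable_on I" if P: "countable_partition_into (dom \<mu>) I P A" for I P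
    proof -
      have Pm: "P i \<in> dom \<mu>" "P i \<subseteq> A" if "i \<in> I" for i
        using P that by (auto simp: countable_partition_into_def)
      then have P\<rho>: "P i \<in> dom \<rho>" if "i \<in> I" for i
        using Pm[OF that] dom_subset_host[of \<mu>] host
        by (intro premeasure_subset_mem[OF \<rho> A]) blast+
      then have "((\<lambda>i. the (\<rho> (P i))) has_sum the (\<rho> A)) I"
        using P by (intro is_premeasure_has_sum[OF \<rho> A]) (auto simp: countable_partition_into_def)
      then have "(\<lambda>i. the (\<rho> (P i))) summable_on I" by (rule has_sum_imp_summable)
      then show ?thesis using eq[OF P\<rho> Pm(1)] by (simp cong: summable_on_cong)
    qed
    moreover have "A \<in> host \<mu>" using A dom_subset_host[of \<rho>] host by auto
    ultimately show ?thesis by (simp add: dom_maximal_extension summable_partitions_def)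
  qed
  then show "\<rho> \<subseteq>\<^sub>m maximal_extension \<mu>"
    using sim by (simp add: map_le_def similar_def)
qed

section \<open>Existence and uniqueness of the measure similar to a premeasure\<close>

lemma is_measure_imp_is_premeasure: "is_measure \<mu> \<Longrightarrow> is_premeasure \<mu>"
  by (simp add: is_measure_def)

lemma is_measure_extends: "is_measure \<mu> \<Longrightarrow> is_premeasure \<nu> \<Longrightarrow> \<nu> \<asymp> \<mu> \<Longrightarrow> \<nu> \<subseteq>\<^sub>m \<mu>"
  by (simp add: is_measure_def)

text \<open>Two measures similar to the same premeasure are similar to each other, so each extends
  the other.\<close>

lemma is_measure_similar_unique:
  assumes \<mu>: "is_measure \<mu>" and \<nu>: "is_measure \<nu>" and \<rho>: "is_premeasure \<rho>"
    and sim: "\<mu> \<asymp> \<rho>" "\<nu> \<asymp> \<rho>"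
  shows "\<mu> = \<nu>"
proof -
  note pre = is_measure_imp_is_premeasure[OF \<mu>] is_measure_imp_is_premeasure[OF \<nu>]
  have eq: "\<mu> \<asymp> \<nu>"
    by (rule similar_trans[OF pre(1) \<rho> pre(2) sim(1) similar_sym[OF sim(2)]])
  show ?thesis
    by (rule map_le_antisym[OF is_measure_extends[OF \<nu> pre(1) eq]
          is_measure_extends[OF \<mu> pre(2) similar_sym[OF eq]]])
qed

lemma measure_similar_to_eq:
  assumes "is_premeasure \<mu>" "is_measure \<nu>" "\<nu> \<asymp> \<mu>"
  shows "measure_similar_to \<mu> = \<nu>"
  unfolding measure_similar_to_def
proof (rule the_equality)
  fix \<rho> assume "is_measure \<rho> \<and> \<rho> \<asymp> \<mu>"
  then show "\<rho> = \<nu>" using is_measure_similar_unique[of \<rho> \<nu> \<mu>] assms by simp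
qed (use assms in simp)

text \<open>The maximal extension is the witness for existence. The last claim is maximality applied
  to \<open>\<mu>\<close> itself, which is a premeasure similar to its measure.\<close>

lemma measure_similar_to:
  fixes \<mu> :: "'a set \<rightharpoonup> 'k::{real_normed_field,banach}"
  assumes "is_premeasure \<mu>"
  shows "is_measure (measure_similar_to \<mu>)" and "measure_similar_to \<mu> \<asymp> \<mu>"
    and "host (measure_similar_to \<mu>) = host \<mu>" and "\<mu> \<subseteq>\<^sub>m measure_similar_to \<mu>"
proof -
  have eq: "measure_similar_to \<mu> = maximal_extension \<mu>"
    by (intro measure_similar_to_eq is_measure_maximal_extension maximal_extension_similar assms)
  show "is_measure (measure_similar_to \<mu>)" "measure_similar_to \<mu> \<asymp> \<mu>"
    "host (measure_similar_to \<mu>) = host \<mu>"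
    unfolding eq
    by (intro is_measure_maximal_extension maximal_extension_similar host_maximal_extension assms)+
  then show "\<mu> \<subseteq>\<^sub>m measure_similar_to \<mu>"
    using assms similar_sym by (blast intro: is_measure_extends)
qed

section \<open>Pointwise images and sums of premeasures\<close>

text \<open>A common form for \<open>complexify\<close>, \<open>pointwise_scale\<close> and the real
  and imaginary parts: all arise from bounded linear maps of the scalars, which commute with
  sums.\<close>

definition pointwise_map :: "('k \<Rightarrow> 'l) \<Rightarrow> ('a set \<rightharpoonup> 'k) \<Rightarrow> ('a set \<rightharpoonup> 'l)" where
  "pointwise_map f \<mu> = (\<lambda>A. map_option f (\<mu> A))"

lemma complexify_eq_pointwise_map: "complexify = pointwise_map complex_of_real"
  by (simp add: fun_eq_iff complexify_def pointwise_map_def)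

lemma pointwise_scale_eq_pointwise_map: "pointwise_scale k = pointwise_map ((*) k)"
  by (simp add: fun_eq_iff pointwise_scale_def pointwise_map_def)

lemma dom_pointwise_map [simp]: "dom (pointwise_map f \<mu>) = dom \<mu>"
  by (auto simp: pointwise_map_def)

lemma the_pointwise_map [simp]: "A \<in> dom \<mu> \<Longrightarrow> the (pointwise_map f \<mu> A) = f (the (\<mu> A))"
  by (auto simp: pointwise_map_def)

lemma host_pointwise_map [simp]: "host (pointwise_map f \<mu>) = host \<mu>"
  by (simp add: host_def)

lemma similar_pointwise_map: "\<mu> \<asymp> \<nu> \<Longrightarrow> pointwise_map f \<mu> \<asymp> pointwise_map f \<nu>"
  unfolding similar_def host_pointwise_map dom_pointwise_map by (simp add: pointwise_map_def)

lemma is_premeasure_pointwise_map: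
  assumes f: "bounded_linear f" and \<mu>: "is_premeasure \<mu>"
  shows "is_premeasure (pointwise_map f \<mu>)"
  unfolding is_premeasure_def dom_pointwise_map
proof (intro conjI ballI allI impI is_premeasure_dom[OF \<mu>])
  fix A I P assume A: "A \<in> dom \<mu>" and P: "countable_partition_into (dom \<mu>) I P A"
  have "P i \<in> dom \<mu>" if "i \<in> I" for i using P that by (auto simp: countable_partition_into_def)
  then show "((\<lambda>i. the (pointwise_map f \<mu> (P i))) has_sum the (pointwise_map f \<mu> A)) I"
    using has_sum_bounded_linear[OF f is_premeasure_has_sum[OF \<mu> A P]]
    unfolding the_pointwise_map[OF A] by (simp cong: has_sum_cong)
qed

lemma dom_pointwise_add: "dom (pointwise_add \<mu> \<nu>) = dom \<mu> \<inter> dom \<nu>"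
  by (auto simp: pointwise_add_def split: if_splits)

lemma the_pointwise_add:
  "A \<in> dom \<mu> \<inter> dom \<nu> \<Longrightarrow> the (pointwise_add \<mu> \<nu> A) = the (\<mu> A) + the (\<nu> A)"
  by (simp add: pointwise_add_def)

lemma host_pointwise_add:
  assumes "is_premeasure \<mu>" "is_premeasure \<nu>" "host \<mu> = host \<nu>"
  shows "host (pointwise_add \<mu> \<nu>) = host \<mu>"
  using delta_ring_Int_same_sigma_ring(2)[of "dom \<mu>" "dom \<nu>"] assms
  by (simp add: host_def dom_pointwise_add is_premeasure_dom)

lemma is_premeasure_pointwise_add:
  assumes \<mu>: "is_premeasure \<mu>" and \<nu>: "is_premeasure \<nu>" and host: "host \<mu> = host \<nu>"
  shows "is_premeasure (pointwise_add \<mu> \<nu>)"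
  unfolding is_premeasure_def dom_pointwise_add
proof (intro conjI ballI allI impI)
  show "delta_ring_of_sets (dom \<mu> \<inter> dom \<nu>)"
    using host by (intro delta_ring_Int_same_sigma_ring(1) is_premeasure_dom \<mu> \<nu>)
      (simp add: host_def)
  fix A I P assume A: "A \<in> dom \<mu> \<inter> dom \<nu>"
    and P: "countable_partition_into (dom \<mu> \<inter> dom \<nu>) I P A"
  have Pm: "P i \<in> dom \<mu> \<inter> dom \<nu>" if "i \<in> I" for i
    using P that by (auto simp: countable_partition_into_def)
  have "countable_partition_into (dom \<mu>) I P A" "countable_partition_into (dom \<nu>) I P A"
    using P by (auto simp: countable_partition_into_def)
  then have "((\<lambda>i. the (\<mu> (P i)) + the (\<nu> (P i))) has_sum the (\<mu> A) + the (\<nu> A)) I"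
    using A by (intro has_sum_add is_premeasure_has_sum \<mu> \<nu>) auto
  then show "((\<lambda>i. the (pointwise_add \<mu> \<nu> (P i))) has_sum the (pointwise_add \<mu> \<nu> A)) I"
    unfolding the_pointwise_add[OF A] by (simp add: the_pointwise_add[OF Pm] cong: has_sum_cong)
qed

section \<open>Real measures as complex measures\<close>

lemma is_premeasure_complexify: "is_premeasure \<mu> \<Longrightarrow> is_premeasure (complexify \<mu>)"
  unfolding complexify_eq_pointwise_map
  by (rule is_premeasure_pointwise_map[OF bounded_linear_of_real])

text \<open>The point is maximality against complex-valued competitors. The real part of such a
  \<open>\<rho>\<close> has the same domain as \<open>\<rho>\<close> and is similar to
  \<open>\<mu>\<close>, so \<open>dom \<rho> \<subseteq> dom \<mu>\<close>; on that domain
  similarity already fixes the values.\<close>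

lemma is_measure_complexify:
  assumes \<mu>: "is_measure \<mu>"
  shows "is_measure (complexify \<mu>)"
  unfolding is_measure_def
proof (intro conjI allI impI is_premeasure_complexify is_measure_imp_is_premeasure[OF \<mu>])
  fix \<rho> :: "'a set \<rightharpoonup> complex"
  assume \<rho>: "is_premeasure \<rho>" and sim: "\<rho> \<asymp> complexify \<mu>"
  have "pointwise_map Re \<rho> \<asymp> pointwise_map Re (complexify \<mu>)"
    using sim by (rule similar_pointwise_map)
  also have "pointwise_map Re (complexify \<mu>) = \<mu>"
    by (simp add: pointwise_map_def complexify_def option.map_comp o_def option.map_ident)
  finally have "pointwise_map Re \<rho> \<subseteq>\<^sub>m \<mu>"
    by (intro is_measure_extends[OF \<mu>] is_premeasure_pointwise_map[OF bounded_linear_Re \<rho>])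
  then have "dom \<rho> \<subseteq> dom (complexify \<mu>)"
    using map_le_implies_dom_le[of "pointwise_map Re \<rho>" \<mu>] by (simp add: complexify_eq_pointwise_map)
  then show "\<rho> \<subseteq>\<^sub>m complexify \<mu>"
    using sim unfolding map_le_def similar_def by blast
qed

lemma host_complexify [simp]: "host (complexify \<mu>) = host \<mu>"
  by (simp add: complexify_eq_pointwise_map)

text \<open>The left-hand side is a measure similar to \<open>complexify \<mu>\<close>, and there is
  only one. This reduces the compatibility of \<open>complexify\<close> with the vector operations
  to pointwise identities.\<close>

lemma complexify_measure_similar_to:
  assumes "is_premeasure \<mu>"
  shows "complexify (measure_similar_to \<mu>) = measure_similar_to (complexify \<mu>)"
proof (rule measure_similar_to_eq[symmetric])
  show "complexify (measure_similar_to \<mu>) \<asymp> complexify \<mu>"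
    unfolding complexify_eq_pointwise_map
    by (intro similar_pointwise_map measure_similar_to(2) assms)
qed (intro is_premeasure_complexify is_measure_complexify measure_similar_to(1) assms)+

lemma complexify_pointwise_add:
  "complexify (pointwise_add \<mu> \<nu>) = pointwise_add (complexify \<mu>) (complexify \<nu>)"
  by (auto simp: fun_eq_iff complexify_def pointwise_add_def)

lemma complexify_pointwise_scale:
  "complexify (pointwise_scale c \<mu>) = pointwise_scale (complex_of_real c) (complexify \<mu>)"
  by (simp add: fun_eq_iff complexify_def pointwise_scale_def option.map_comp o_def)

section \<open>Vector operations on \<open>measures_on Q\<close>\<close>

lemma measures_on_is_premeasure: "\<mu> \<in> measures_on Q \<Longrightarrow> is_premeasure \<mu>"
  by (simp add: measures_on_def is_measure_def)

lemma complexify_measures_on: "\<mu> \<in> measures_on Q \<Longrightarrow> complexify \<mu> \<in> measures_on Q"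
  by (simp add: measures_on_def is_measure_complexify)

lemma measures_on_pointwise_add:
  assumes "\<mu> \<in> measures_on Q" "\<nu> \<in> measures_on Q"
  shows "is_premeasure (pointwise_add \<mu> \<nu>)" "host (pointwise_add \<mu> \<nu>) = Q"
  using assms is_premeasure_pointwise_add[of \<mu> \<nu>] host_pointwise_add[of \<mu> \<nu>]
  by (simp_all add: measures_on_def is_measure_imp_is_premeasure)

lemma measures_on_pointwise_scale:
  assumes "\<mu> \<in> measures_on Q"
  shows "is_premeasure (pointwise_scale k \<mu>)" "host (pointwise_scale k \<mu>) = Q"
  using assms
  by (simp_all add: pointwise_scale_eq_pointwise_map is_premeasure_pointwise_map
      bounded_linear_mult_right measures_on_def is_measure_imp_is_premeasure)

lemma measure_add_measures_on:
  fixes \<mu> \<nu> :: "'a set \<rightharpoonup> 'k::{real_normed_field,banach}"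
  assumes "\<mu> \<in> measures_on Q" "\<nu> \<in> measures_on Q"
  shows "\<mu> \<oplus>\<^sub>m \<nu> \<in> measures_on Q"
  using measures_on_pointwise_add[OF assms] by (simp add: measure_add_def measures_on_def measure_similar_to)

lemma measure_scale_measures_on:
  fixes \<mu> :: "'a set \<rightharpoonup> 'k::{real_normed_field,banach}"
  assumes "\<mu> \<in> measures_on Q"
  shows "k \<odot>\<^sub>m \<mu> \<in> measures_on Q"
  using measures_on_pointwise_scale[OF assms]
  by (simp add: measure_scale_def measures_on_def measure_similar_to)

lemma complexify_measure_add:
  assumes "\<mu> \<in> measures_on Q" "\<nu> \<in> measures_on Q"
  shows "complexify (\<mu> \<oplus>\<^sub>m \<nu>) = complexify \<mu> \<oplus>\<^sub>m complexify \<nu>"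
  using measures_on_pointwise_add(1)[OF assms]
  by (simp add: measure_add_def complexify_measure_similar_to complexify_pointwise_add)

lemma complexify_measure_scale:
  assumes "\<mu> \<in> measures_on Q"
  shows "complexify (c \<odot>\<^sub>m \<mu>) = complex_of_real c \<odot>\<^sub>m complexify \<mu>"
  using measures_on_pointwise_scale(1)[OF assms]
  by (simp add: measure_scale_def complexify_measure_similar_to complexify_pointwise_scale)

lemma measure_zero_measures_on:
  assumes Q: "sigma_ring_of_sets Q"
  shows "(measure_zero Q :: 'a set \<rightharpoonup> 'k::real_normed_field) \<in> measures_on Q" (is "?z \<in> _")
proof -
  have dom: "dom ?z = Q" by (auto simp: measure_zero_def split: if_splits)
  have host: "host ?z = Q"
    unfolding host_def dom
    by (intro equalityI sigma_ring_generated_minimal sigma_ring_generated_superset Q order_refl)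
  have "is_premeasure ?z"
    unfolding is_premeasure_def dom
  proof (intro conjI ballI allI impI sigma_ring_imp_delta_ring[OF Q])
    fix A I P assume A: "A \<in> Q" and P: "countable_partition_into Q I P A"
    then have "the (?z (P i)) = 0" if "i \<in> I" for i
      using that by (auto simp: countable_partition_into_def measure_zero_def)
    moreover have "the (?z A) = 0" using A by (simp add: measure_zero_def)
    ultimately show "((\<lambda>i. the (?z (P i))) has_sum the (?z A)) I"
      by (metis has_sum_0)
  qed
  moreover have "\<nu> \<subseteq>\<^sub>m ?z" if "\<nu> \<asymp> ?z" for \<nu>
  proof -
    have "dom \<nu> \<subseteq> Q" using that dom_subset_host[of \<nu>] host by (simp add: similar_def)
    then show ?thesis using that dom unfolding map_le_def similar_def by blast
  qed
  ultimately show ?thesis using host by (simp add: measures_on_def is_measure_def)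
qed

lemma complexify_measure_zero: "complexify (measure_zero Q) = measure_zero Q"
  by (simp add: fun_eq_iff complexify_def measure_zero_def)

section \<open>Real and imaginary parts of a complex measure\<close>

text \<open>Each operation passes from a pointwise result to a measure extending it, so where
  \<open>p\<close> and \<open>q\<close> are both defined the combination is evaluated pointwise. The
  domain of the combination may be larger.\<close>

lemma measure_add_scale_i_eq:
  assumes p: "p \<in> measures_on Q" and q: "q \<in> measures_on Q" and A: "A \<in> dom p" "A \<in> dom q"
  shows "(complexify p \<oplus>\<^sub>m \<i> \<odot>\<^sub>m complexify q) A = Some (Complex (the (p A)) (the (q A)))"
proof -
  have cp: "complexify p \<in> measures_on Q" and cq: "complexify q \<in> measures_on Q"
    using p q by (simp_all add: complexify_measures_on)
  have "pointwise_scale \<i> (complexify q) \<subseteq>\<^sub>m \<i> \<odot>\<^sub>m complexify q"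
    unfolding measure_scale_def by (intro measure_similar_to(4) measures_on_pointwise_scale(1)[OF cq])
  moreover have "pointwise_scale \<i> (complexify q) A = Some (\<i> * the (q A))"
    using A(2) by (auto simp: pointwise_scale_def complexify_def)
  ultimately have iq: "(\<i> \<odot>\<^sub>m complexify q) A = Some (\<i> * the (q A))"
    by (metis domI map_le_def)
  have "pointwise_add (complexify p) (\<i> \<odot>\<^sub>m complexify q) \<subseteq>\<^sub>m complexify p \<oplus>\<^sub>m \<i> \<odot>\<^sub>m complexify q"
    unfolding measure_add_def
    by (intro measure_similar_to(4) measures_on_pointwise_add(1)[OF cp]
        measure_scale_measures_on[OF cq])
  moreover have "pointwise_add (complexify p) (\<i> \<odot>\<^sub>m complexify q) A
      = Some (Complex (the (p A)) (the (q A)))"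
    using A(1) iq by (auto simp: pointwise_add_def complexify_def Complex_eq)
  ultimately show ?thesis by (metis domI map_le_def)
qed

lemma pointwise_map_Re_Im_measures_on:
  assumes "\<mu> \<in> measures_on Q"
  shows "is_premeasure (pointwise_map Re \<mu>)" "is_premeasure (pointwise_map Im \<mu>)"
    and "host \<mu> = Q"
  using assms
  by (auto simp: measures_on_def is_measure_imp_is_premeasure
      intro!: is_premeasure_pointwise_map bounded_linear_Re bounded_linear_Im)

text \<open>On \<open>dom \<mu>\<close> the measures \<open>p\<close> and \<open>q\<close> extend
  the real and imaginary parts, so the combination agrees there with \<open>\<mu>\<close>. Two
  similar measures are equal, which also settles the domains.\<close>

lemma measure_Re_Im_decomposition:
  assumes \<mu>: "\<mu> \<in> measures_on Q"
  defines "p \<equiv> measure_similar_to (pointwise_map Re \<mu>)"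
    and "q \<equiv> measure_similar_to (pointwise_map Im \<mu>)"
  shows "p \<in> measures_on Q" "q \<in> measures_on Q" "\<mu> = complexify p \<oplus>\<^sub>m \<i> \<odot>\<^sub>m complexify q"
proof -
  note ReIm = pointwise_map_Re_Im_measures_on[OF \<mu>]
  show p: "p \<in> measures_on Q" and q: "q \<in> measures_on Q"
    using ReIm by (simp_all add: p_def q_def measures_on_def measure_similar_to)
  let ?s = "complexify p \<oplus>\<^sub>m \<i> \<odot>\<^sub>m complexify q"
  have s: "?s \<in> measures_on Q"
    by (intro measure_add_measures_on measure_scale_measures_on complexify_measures_on p q)
  have "?s A = \<mu> A" if A: "A \<in> dom \<mu>" for A
  proof -
    have "p A = pointwise_map Re \<mu> A" "q A = pointwise_map Im \<mu> A"
      using measure_similar_to(4)[OF ReIm(1)] measure_similar_to(4)[OF ReIm(2)] A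
      by (simp_all add: p_def q_def map_le_def)
    then show ?thesis
      using A by (subst measure_add_scale_i_eq[OF p q]) (auto simp: pointwise_map_def)
  qed
  then have sim: "?s \<asymp> \<mu>" using s \<mu> by (simp add: similar_def measures_on_def)
  have "\<mu> \<asymp> \<mu>" by (simp add: similar_def)
  then show "\<mu> = ?s"
    using s \<mu> sim is_measure_similar_unique[of \<mu> ?s \<mu>]
    by (simp add: measures_on_def is_measure_imp_is_premeasure)
qed

lemma measure_Re_Im_decomposition_unique:
  assumes \<mu>: "\<mu> \<in> measures_on Q" and p: "p \<in> measures_on Q" and q: "q \<in> measures_on Q"
    and eq: "\<mu> = complexify p \<oplus>\<^sub>m \<i> \<odot>\<^sub>m complexify q"
  shows "p = measure_similar_to (pointwise_map Re \<mu>)"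
    and "q = measure_similar_to (pointwise_map Im \<mu>)"
proof -
  note ReIm = pointwise_map_Re_Im_measures_on[OF \<mu>]
  have host: "host p = Q" "host q = Q" using p q by (auto simp: measures_on_def)
  note pre = measures_on_is_premeasure[OF p] measures_on_is_premeasure[OF q]
  have val: "\<mu> A = Some (Complex (the (p A)) (the (q A)))" if "A \<in> dom p" "A \<in> dom q" for A
    using measure_add_scale_i_eq[OF p q that] eq by simp
  \<comment> \<open>The formula \<open>val\<close> speaks only about sets in both
    \<open>dom p\<close> and \<open>dom q\<close>. Taking \<open>dom q\<close> as the comparing
    \<delta>-ring supplies the second membership; for \<open>q\<close> the roles are
    exchanged.\<close>
  have "p \<asymp> pointwise_map Re \<mu>"
  proof (rule similarI_on_delta_ring[OF pre(1) ReIm(1) is_premeasure_dom[OF pre(2)]])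
    fix A assume "A \<in> dom q" "A \<in> dom p"
    then show "p A = pointwise_map Re \<mu> A" using val[of A] by (auto simp: pointwise_map_def)
  qed (use host ReIm(3) in \<open>simp_all flip: host_def\<close>)
  then show "p = measure_similar_to (pointwise_map Re \<mu>)"
    using p by (intro measure_similar_to_eq[symmetric] ReIm) (simp_all add: measures_on_def)
  have "q \<asymp> pointwise_map Im \<mu>"
  proof (rule similarI_on_delta_ring[OF pre(2) ReIm(2) is_premeasure_dom[OF pre(1)]])
    fix A assume "A \<in> dom p" "A \<in> dom q"
    then show "q A = pointwise_map Im \<mu> A" using val[of A] by (auto simp: pointwise_map_def)
  qed (use host ReIm(3) in \<open>simp_all flip: host_def\<close>)
  then show "q = measure_similar_to (pointwise_map Im \<mu>)"
    using q by (intro measure_similar_to_eq[symmetric] ReIm) (simp_all add: measures_on_def)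
qed

text \<open>Closure holds because \<open>complexify\<close> carries the real zero, sums and
  multiples to the complex ones.\<close>

lemma real_subspace_complexify_measures_on:
  assumes "sigma_ring_of_sets Q"
  shows "real_subspace_of_measures Q (complexify ` measures_on Q)"
  unfolding real_subspace_of_measures_def
proof (intro conjI ballI allI)
  show "complexify ` measures_on Q \<subseteq> measures_on Q" by (auto intro: complexify_measures_on)
  show "measure_zero Q \<in> complexify ` measures_on Q"
    using measure_zero_measures_on[OF assms] complexify_measure_zero[of Q] by (metis imageI)
  fix \<mu> assume "\<mu> \<in> complexify ` measures_on Q"
  then obtain \<mu>' where \<mu>': "\<mu>' \<in> measures_on Q" "\<mu> = complexify \<mu>'" by blast
  show "complex_of_real c \<odot>\<^sub>m \<mu> \<in> complexify ` measures_on Q" for c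
    using \<mu>' measure_scale_measures_on[OF \<mu>'(1)] by (simp flip: complexify_measure_scale)
  fix \<nu> assume "\<nu> \<in> complexify ` measures_on Q"
  then obtain \<nu>' where \<nu>': "\<nu>' \<in> measures_on Q" "\<nu> = complexify \<nu>'" by blast
  show "\<mu> \<oplus>\<^sub>m \<nu> \<in> complexify ` measures_on Q"
    using \<mu>' \<nu>' measure_add_measures_on[OF \<mu>'(1) \<nu>'(1)] by (simp flip: complexify_measure_add)
qed

text \<open>Closure of the image under the complex operations does not yet say that the operations
  on real measures are the induced ones; the second and third conjuncts add this. Pairs express
  joint uniqueness of the two parts.\<close>

theorem proposition7p12:
  fixes Q :: "'a set set"
  assumes "sigma_ring_of_sets Q"
  shows "real_subspace_of_measures Q (complexify ` measures_on Q) \<and>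
    (\<forall>\<mu>\<in>measures_on Q. \<forall>\<nu>\<in>measures_on Q.
       complexify (\<mu> \<oplus>\<^sub>m \<nu>) = complexify \<mu> \<oplus>\<^sub>m complexify \<nu>) \<and>
    (\<forall>c::real. \<forall>\<mu>\<in>measures_on Q.
       complexify (c \<odot>\<^sub>m \<mu>) = complex_of_real c \<odot>\<^sub>m complexify \<mu>) \<and>
    (\<forall>\<mu>\<in>(measures_on Q :: ('a set \<rightharpoonup> complex) set).
       \<exists>!p. p \<in> measures_on Q \<times> measures_on Q \<and>
            \<mu> = complexify (fst p) \<oplus>\<^sub>m \<i> \<odot>\<^sub>m complexify (snd p))"
proof (intro conjI ballI allI)
  show "real_subspace_of_measures Q (complexify ` measures_on Q)"
    by (rule real_subspace_complexify_measures_on[OF assms])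
next
  fix \<mu> :: "'a set \<rightharpoonup> complex" assume \<mu>: "\<mu> \<in> measures_on Q"
  let ?p = "(measure_similar_to (pointwise_map Re \<mu>), measure_similar_to (pointwise_map Im \<mu>))"
  show "\<exists>!p. p \<in> measures_on Q \<times> measures_on Q \<and>
            \<mu> = complexify (fst p) \<oplus>\<^sub>m \<i> \<odot>\<^sub>m complexify (snd p)"
  proof (rule ex1I)
    show "?p \<in> measures_on Q \<times> measures_on Q \<and>
        \<mu> = complexify (fst ?p) \<oplus>\<^sub>m \<i> \<odot>\<^sub>m complexify (snd ?p)"
      using measure_Re_Im_decomposition[OF \<mu>] by simp
  next
    fix p assume "p \<in> measures_on Q \<times> measures_on Q \<and>
      \<mu> = complexify (fst p) \<oplus>\<^sub>m \<i> \<odot>\<^sub>m complexify (snd p)"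
    then show "p = ?p"
      using measure_Re_Im_decomposition_unique[OF \<mu>, of "fst p" "snd p"]
      by (auto simp: prod_eq_iff)
  qed
qed (rule complexify_measure_add complexify_measure_scale; assumption)+

end
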